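(* Given a multiset $W=\{w_1,\ldots,w_n\}$ of $n$ integer weights, a minimax tree for $W$ can be built in $O(n)$ time.
   Context: All trees are binary (each internal node has at most two children). For a multiset $W=\{w_1,\ldots,w_n\}$ of weights, consider binary trees with $n$ leaves whose leaves are labelled bijectively by the elements of $W$. Each leaf has weight equal to its label, and each internal node has weight equal to the maximum of its children's weights plus $1$; equivalently, the root's weight is $\max_i\{w_i+\ell_i\}$, where $\ell_i$ is the depth of the leaf labelled $w_i$. A minimax tree for $W$ is such a tree whose root weight is as small as possible. This minimum root weight is called the minimax cost of $W$, denoted $M(W)$. *)

theory Defs
  imports "HOL-Library.Multiset" "HOL-Library.Landau_Symbols"
begin

section \<open>Minimax trees\<close>

text \<open>An internal node has one or two children, so unary nodes are admitted as well.\<close>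

datatype wtree = Leaf int | Node1 wtree | Node2 wtree wtree

fun leaf_weights :: "wtree \<Rightarrow> int multiset" where
  "leaf_weights (Leaf w) = {#w#}"
| "leaf_weights (Node1 t) = leaf_weights t"
| "leaf_weights (Node2 l r) = leaf_weights l + leaf_weights r"

fun weight :: "wtree \<Rightarrow> int" where
  "weight (Leaf w) = w"
| "weight (Node1 t) = weight t + 1"
| "weight (Node2 l r) = max (weight l) (weight r) + 1"

definition minimax_tree :: "int multiset \<Rightarrow> wtree \<Rightarrow> bool" where
  "minimax_tree W t \<longleftrightarrow> is_arg_min weight (\<lambda>t'. leaf_weights t' = W) t"


section \<open>A random access machine with uniform cost\<close>

text \<open>
  A state consists of the contents of the registers and of the memory cells, all of them integers.
  Memory cells are addressed by nonnegative integers, and an access to a negative address has no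
  execution. The only arithmetic operations are addition and subtraction, the only tests are
  comparisons of two registers. Every elementary command and every evaluation of a test takes
  one unit of time; programs are structured rather than built from jumps.
\<close>

type_synonym reg = nat
type_synonym state = "(reg \<Rightarrow> int) \<times> (int \<Rightarrow> int)"

datatype com =
    Skip
  | SetConst reg int
  | Add reg reg reg
  | Sub reg reg reg
  | Load reg reg
  | Store reg reg
  | Seq com com
  | IfLess reg reg com com
  | WhileLess reg reg com

text \<open>\<open>exec c s k s'\<close>: started in \<open>s\<close>, the program \<open>c\<close> terminates in \<open>s'\<close> after \<open>k\<close> units of time.\<close>

inductive exec :: "com \<Rightarrow> state \<Rightarrow> nat \<Rightarrow> state \<Rightarrow> bool" where
  exec_Skip: "exec Skip s 1 s"
| exec_SetConst: "exec (SetConst x i) (R, M) 1 (R(x := i), M)"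
| exec_Add: "exec (Add x a b) (R, M) 1 (R(x := R a + R b), M)"
| exec_Sub: "exec (Sub x a b) (R, M) 1 (R(x := R a - R b), M)"
| exec_Load: "0 \<le> R a \<Longrightarrow> exec (Load x a) (R, M) 1 (R(x := M (R a)), M)"
| exec_Store: "0 \<le> R a \<Longrightarrow> exec (Store a x) (R, M) 1 (R, M(R a := R x))"
| exec_Seq: "exec c1 s j s' \<Longrightarrow> exec c2 s' k s'' \<Longrightarrow> exec (Seq c1 c2) s (j + k) s''"
| exec_IfTrue: "fst s a < fst s b \<Longrightarrow> exec c1 s k s' \<Longrightarrow> exec (IfLess a b c1 c2) s (1 + k) s'"
| exec_IfFalse: "\<not> fst s a < fst s b \<Longrightarrow> exec c2 s k s' \<Longrightarrow> exec (IfLess a b c1 c2) s (1 + k) s'"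
| exec_WhileFalse: "\<not> fst s a < fst s b \<Longrightarrow> exec (WhileLess a b c) s 1 s"
| exec_WhileTrue: "fst s a < fst s b \<Longrightarrow> exec c s j s' \<Longrightarrow> exec (WhileLess a b c) s' k s''
    \<Longrightarrow> exec (WhileLess a b c) s (1 + j + k) s''"

inductive_cases exec_elims:
  "exec Skip s k s'"
  "exec (SetConst x i) s k s'"
  "exec (Add x a b) s k s'"
  "exec (Sub x a b) s k s'"
  "exec (Load x a) s k s'"
  "exec (Store a x) s k s'"
  "exec (Seq c1 c2) s k s'"
  "exec (IfLess a b c1 c2) s k s'"
  "exec (WhileLess a b c) s k s'"

lemma exec_deterministic:
  "exec c s k s' \<Longrightarrow> exec c s k' s'' \<Longrightarrow> k' = k \<and> s'' = s'"
proof (induction arbitrary: k' s'' rule: exec.induct)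
  case (exec_Seq c1 s j s' c2 k s3)
  from exec_Seq.prems obtain j' k2 s2 where "exec c1 s j' s2" "exec c2 s2 k2 s''" "k' = j' + k2"
    by (auto elim: exec_elims(7))
  with exec_Seq.IH show ?case by metis
next
  case (exec_IfTrue s a b c1 k s' c2)
  from exec_IfTrue.prems exec_IfTrue.hyps(1) obtain k2 where "exec c1 s k2 s''" "k' = 1 + k2"
    by (auto elim: exec_elims(8))
  with exec_IfTrue.IH show ?case by metis
next
  case (exec_IfFalse s a b c2 k s' c1)
  from exec_IfFalse.prems exec_IfFalse.hyps(1) obtain k2 where "exec c2 s k2 s''" "k' = 1 + k2"
    by (auto elim: exec_elims(8))
  with exec_IfFalse.IH show ?case by metis
next
  case (exec_WhileFalse s a b c)
  from exec_WhileFalse.prems show ?case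
    by (rule exec_elims(9)) (use exec_WhileFalse.hyps in auto)
next
  case (exec_WhileTrue s a b c j s' k s3)
  from exec_WhileTrue.prems obtain j' k2 s2
    where "exec c s j' s2" "exec (WhileLess a b c) s2 k2 s''" "k' = 1 + j' + k2"
    by (rule exec_elims(9)) (use exec_WhileTrue.hyps(1) in auto)
  with exec_WhileTrue.IH show ?case by metis
qed (auto elim: exec_elims(1-6))


section \<open>Input and output conventions\<close>

text \<open>
  The weights, listed in an arbitrary order, occupy the cells \<open>0, \<dots>, n - 1\<close>, and register \<open>0\<close>
  contains \<open>n\<close>. Nothing is assumed about the other registers and cells.
\<close>

definition input_state :: "int multiset \<Rightarrow> state \<Rightarrow> bool" where
  "input_state W s \<longleftrightarrow> (\<exists>ws. mset ws = W \<and> fst s 0 = int (length ws)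
     \<and> (\<forall>i < length ws. snd s (int i) = ws ! i))"

text \<open>
  \<open>tree_at M p t A\<close>: the memory \<open>M\<close> stores \<open>t\<close> as a linked structure with root at address \<open>p\<close>,
  and \<open>A\<close> is the set of cells used. Every node is a block of three cells: the number of children
  of the node, followed by its label (for a leaf) or the addresses of its children. Blocks of different
  nodes are disjoint, so no subtree is shared.
\<close>

fun tree_at :: "(int \<Rightarrow> int) \<Rightarrow> int \<Rightarrow> wtree \<Rightarrow> int set \<Rightarrow> bool" where
  "tree_at M p (Leaf w) A \<longleftrightarrow> 0 \<le> p \<and> M p = 0 \<and> M (p + 1) = w \<and> A = {p..p + 2}"
| "tree_at M p (Node1 t) A \<longleftrightarrow> 0 \<le> p \<and> M p = 1 \<and>
     (\<exists>B. tree_at M (M (p + 1)) t B \<and> {p..p + 2} \<inter> B = {} \<and> A = {p..p + 2} \<union> B)"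
| "tree_at M p (Node2 l r) A \<longleftrightarrow> 0 \<le> p \<and> M p = 2 \<and>
     (\<exists>B C. tree_at M (M (p + 1)) l B \<and> tree_at M (M (p + 2)) r C \<and>
        {p..p + 2} \<inter> B = {} \<and> {p..p + 2} \<inter> C = {} \<and> B \<inter> C = {} \<and> A = {p..p + 2} \<union> B \<union> C)"

text \<open>The address of the root of the output tree is returned in register \<open>0\<close>.\<close>

definition output_tree :: "state \<Rightarrow> wtree \<Rightarrow> bool" where
  "output_tree s t \<longleftrightarrow> (\<exists>A. tree_at (snd s) (fst s 0) t A)"

end

theory Submission
  imports Defs "HOL-Library.Disjoint_Sets"
begin

text \<open>
  Write \<open>b\<close> for the maximal weight minus \<open>n\<close>, and let a weight \<open>w\<close> have level \<open>nat (w - b)\<close>. The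
  truncation raises weights below \<open>b\<close> to \<open>b\<close>, but the Kraft inequality survives it: if a tree with
  \<open>n\<close> leaves has weight \<open>h\<close>, then the sum of \<open>2 ^ nat (w - b)\<close> over its leaves is at most
  \<open>2 ^ nat (h - b)\<close>, because the tree may be assumed to have depth below \<open>n\<close>. Hence only \<open>O(n)\<close> levels
  matter and the leaves can be distributed into buckets, one for each level.

  Going through the levels upwards, the trees in the bucket of level \<open>v\<close> are joined in pairs, which go to
  level \<open>v + 1\<close>, and a tree left over is moved to level \<open>v + 1\<close> unchanged. Joining preserves the sum of
  \<open>2 ^ level\<close> over all trees, and the moves at levels below \<open>v\<close> increase it by less than \<open>2 ^ v\<close> in total.
  So if the last tree arrives at level \<open>m\<close>, the Kraft sum of the weights exceeds \<open>2 ^ (m - 1)\<close>, and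
  no tree has weight below \<open>b + m\<close>.
\<close>

section \<open>Kraft's inequality for clamped weights\<close>

lemma leaf_weights_nonempty: "leaf_weights t \<noteq> {#}"
  by (induction t) auto

lemma weight_ge_leaf: "w \<in># leaf_weights t \<Longrightarrow> w \<le> weight t"
  by (induction t) force+

text \<open>Truncation spoils the halving of the exponent only where \<open>h <= b\<close>. Under
  the size bound a node with two children has \<open>h > b\<close>, and since each side takes at
  least one leaf, the bound passes to both children with \<open>h - 1\<close>. A unary node is
  skipped, keeping \<open>h\<close>.\<close>

lemma kraft_clamped:
  assumes "weight t \<le> h" "b + int (size (leaf_weights t)) \<le> h + 1"
  shows "(\<Sum>w\<in>#leaf_weights t. 2 ^ nat (w - b)) \<le> (2::nat) ^ nat (h - b)"
  using assms
proof (induction t arbitrary: h)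
  case (Leaf w)
  then show ?case by (auto intro: power_increasing)
next
  case (Node1 t)
  then show ?case by simp
next
  case (Node2 l r)
  have pos: "size (leaf_weights l) > 0" "size (leaf_weights r) > 0"
    using leaf_weights_nonempty by (simp_all add: nonempty_has_size)
  have "(\<Sum>w\<in>#leaf_weights l. 2 ^ nat (w - b)) \<le> (2::nat) ^ nat (h - 1 - b)"
    using Node2.prems pos by (intro Node2.IH(1)) auto
  moreover have "(\<Sum>w\<in>#leaf_weights r. 2 ^ nat (w - b)) \<le> (2::nat) ^ nat (h - 1 - b)"
    using Node2.prems pos by (intro Node2.IH(2)) auto
  moreover have "nat (h - b) = Suc (nat (h - 1 - b))"
    using Node2.prems pos by auto
  ultimately show ?case by simp
qed

section \<open>Running time and weakest preconditions\<close>

definition runs :: "com \<Rightarrow> state \<Rightarrow> nat \<Rightarrow> (state \<Rightarrow> bool) \<Rightarrow> bool" where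
  "runs c s k Q \<longleftrightarrow> (\<exists>j s'. exec c s j s' \<and> j \<le> k \<and> Q s')"

lemma runs_mono: "runs c s j Q \<Longrightarrow> j \<le> k \<Longrightarrow> runs c s k Q"
  unfolding runs_def by fastforce

lemma runs_Seq:
  assumes "runs c1 s j P" "\<And>s'. P s' \<Longrightarrow> runs c2 s' k Q"
  shows "runs (Seq c1 c2) s (j + k) Q"
proof -
  obtain j' s' where 1: "exec c1 s j' s'" "j' \<le> j" "P s'" using assms(1) by (auto simp: runs_def)
  obtain k' s'' where 2: "exec c2 s' k' s''" "k' \<le> k" "Q s''"
    using assms(2)[OF 1(3)] by (auto simp: runs_def)
  show ?thesis unfolding runs_def using exec_Seq[OF 1(1) 2(1)] 1 2 add_mono by blast
qed

text \<open>The measure bounds the number of iterations; each pays one unit for the test and at most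
  \<open>d\<close> for the body, and the failing test at the end costs one more.\<close>

lemma runs_While:
  fixes \<mu> :: "state \<Rightarrow> nat"
  assumes "\<And>s. I s \<Longrightarrow> fst s a < fst s b \<Longrightarrow> runs c s d (\<lambda>s'. I s' \<and> \<mu> s' < \<mu> s)"
    and "I s"
  shows "runs (WhileLess a b c) s (1 + (1 + d) * \<mu> s) (\<lambda>s'. I s' \<and> \<not> fst s' a < fst s' b)"
  using assms(2)
proof (induction "\<mu> s" arbitrary: s rule: less_induct)
  case less
  show ?case
  proof (cases "fst s a < fst s b")
    case True
    obtain j s' where s': "exec c s j s'" "j \<le> d" "I s'" "\<mu> s' < \<mu> s"
      using assms(1)[OF less.prems True] by (auto simp: runs_def)
    obtain k s'' where s'': "exec (WhileLess a b c) s' k s''" "k \<le> 1 + (1 + d) * \<mu> s'"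
      "I s''" "\<not> fst s'' a < fst s'' b"
      using less.hyps[OF s'(4,3)] by (auto simp: runs_def)
    have "1 + d + k \<le> 1 + (1 + d) * Suc (\<mu> s')" using s''(2) by simp
    also have "\<dots> \<le> 1 + (1 + d) * \<mu> s" using s'(4) by (intro add_left_mono mult_left_mono) auto
    finally have "1 + j + k \<le> 1 + (1 + d) * \<mu> s" using s'(2) by simp
    then show ?thesis unfolding runs_def
      using exec_WhileTrue[OF True s'(1) s''(1)] s'' by blast
  next
    case False
    have "exec (WhileLess a b c) s 1 s" using False by (rule exec_WhileFalse)
    then show ?thesis unfolding runs_def using False less.prems by fastforce
  qed
qed

section \<open>Loop-free programs\<close>

fun cost :: "com \<Rightarrow> nat" where
  "cost (Seq c1 c2) = cost c1 + cost c2"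
| "cost (IfLess a b c1 c2) = 1 + max (cost c1) (cost c2)"
| "cost _ = 1"

text \<open>Loops get \<open>False\<close>, which makes the dummy value of \<open>cost\<close> on
  them harmless in \<open>runs_wp\<close>; they are treated by \<open>runs_While\<close>
  instead.\<close>

fun wp :: "com \<Rightarrow> (state \<Rightarrow> bool) \<Rightarrow> state \<Rightarrow> bool" where
  "wp Skip Q (R, M) = Q (R, M)"
| "wp (SetConst x i) Q (R, M) = Q (R(x := i), M)"
| "wp (Add x a b) Q (R, M) = Q (R(x := R a + R b), M)"
| "wp (Sub x a b) Q (R, M) = Q (R(x := R a - R b), M)"
| "wp (Load x a) Q (R, M) = (0 \<le> R a \<and> Q (R(x := M (R a)), M))"
| "wp (Store a x) Q (R, M) = (0 \<le> R a \<and> Q (R, M(R a := R x)))"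
| "wp (Seq c1 c2) Q (R, M) = wp c1 (wp c2 Q) (R, M)"
| "wp (IfLess a b c1 c2) Q (R, M) = (if R a < R b then wp c1 Q (R, M) else wp c2 Q (R, M))"
| "wp (WhileLess a b c) Q (R, M) = False"

lemma runs_wp: "wp c Q s \<Longrightarrow> runs c s (cost c) Q"
proof (induction c arbitrary: Q s)
  case (Seq c1 c2)
  obtain R M where s: "s = (R, M)" by force
  show ?case unfolding cost.simps
  proof (rule runs_Seq)
    show "runs c1 s (cost c1) (wp c2 Q)" using Seq s by simp
    show "runs c2 s' (cost c2) Q" if "wp c2 Q s'" for s' using Seq that by blast
  qed
next
  case (IfLess a b c1 c2)
  obtain R M where s: "s = (R, M)" by force
  show ?case
  proof (cases "R a < R b")
    case True
    then have "runs c1 s (cost c1) Q" using IfLess s by simp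
    then obtain j s' where "exec c1 s j s'" "j \<le> cost c1" "Q s'" by (auto simp: runs_def)
    then show ?thesis unfolding runs_def using True s
      by (intro exI[of _ "1 + j"] exI[of _ s'] conjI exec_IfTrue) auto
  next
    case False
    then have "runs c2 s (cost c2) Q" using IfLess s by simp
    then obtain j s' where "exec c2 s j s'" "j \<le> cost c2" "Q s'" by (auto simp: runs_def)
    then show ?thesis unfolding runs_def using False s
      by (intro exI[of _ "1 + j"] exI[of _ s'] conjI exec_IfFalse) auto
  qed
next
  case Skip
  then show ?case unfolding runs_def by (cases s) (auto intro!: exI exec.intros)
next
  case (SetConst x i)
  then show ?case unfolding runs_def by (cases s) (auto intro!: exI exec.intros)
next
  case (Add x a b)
  then show ?case unfolding runs_def by (cases s) (auto intro!: exI exec.intros)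
next
  case (Sub x a b)
  then show ?case unfolding runs_def by (cases s) (auto intro!: exI exec.intros)
next
  case (Load x a)
  then show ?case unfolding runs_def by (cases s) (auto intro!: exI exec.intros)
next
  case (Store a x)
  then show ?case unfolding runs_def by (cases s) (auto intro!: exI exec.intros)
next
  case (WhileLess a b c)
  then show ?case by (cases s) auto
qed

primrec block :: "com list \<Rightarrow> com" where
  "block [] = Skip"
| "block (c # cs) = Seq c (block cs)"

section \<open>Linked lists of trees in memory\<close>

lemma tree_at_root: "tree_at M a t A \<Longrightarrow> 0 \<le> a \<and> a \<in> A"
  by (cases t) auto

lemma tree_at_cong:
  assumes "tree_at M a t A" "\<And>c. c \<in> A \<Longrightarrow> M' c = M c"
  shows "tree_at M' a t A"
  using assms
proof (induction t arbitrary: a A)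
  case (Node1 t)
  then obtain B where B: "tree_at M (M (a + 1)) t B" "{a..a + 2} \<inter> B = {}" "A = {a..a + 2} \<union> B"
    by auto
  then have "tree_at M' (M (a + 1)) t B" using Node1 by auto
  then show ?case using Node1.prems B by auto
next
  case (Node2 l r)
  then obtain B C where B: "tree_at M (M (a + 1)) l B" "tree_at M (M (a + 2)) r C"
    "{a..a + 2} \<inter> B = {}" "{a..a + 2} \<inter> C = {}" "B \<inter> C = {}" "A = {a..a + 2} \<union> B \<union> C"
    by auto
  then have "tree_at M' (M (a + 1)) l B" "tree_at M' (M (a + 2)) r C" using Node2 by auto
  then show ?case using Node2.prems B by auto
qed auto

text \<open>
  Every block gets a fourth cell, which links the root of a tree to the next root in its list.
\<close>

definition owned :: "(int \<Rightarrow> int) \<Rightarrow> int \<Rightarrow> wtree \<Rightarrow> int set \<Rightarrow> bool" where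
  "owned M a t B \<longleftrightarrow> a + 3 \<in> B \<and> (\<exists>A. tree_at M a t A \<and> A \<subseteq> B - {a + 3})"

lemma owned_root: "owned M a t B \<Longrightarrow> 0 \<le> a \<and> a \<in> B \<and> a + 3 \<in> B"
  using tree_at_root by (fastforce simp: owned_def)

text \<open>The tree itself avoids the cell \<open>a + 3\<close>, so relinking its root into another
  list does not disturb it. \<open>forest_push\<close> relies on this exemption.\<close>

lemma owned_cong:
  assumes "owned M a t B" "\<And>c. c \<in> B \<Longrightarrow> c \<noteq> a + 3 \<Longrightarrow> M' c = M c"
  shows "owned M' a t B"
  using assms tree_at_cong[of M a t _ M'] unfolding owned_def by blast

lemma owned_Leaf:
  assumes "0 \<le> p" "M p = 0" "M (p + 1) = w"
  shows "owned M p (Leaf w) {p..<p + 4}"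
  using assms by (auto simp: owned_def)

text \<open>The new tree takes over everything its subtrees own, including their link cells, which
  are dead from now on.\<close>

lemma owned_Node2:
  assumes "owned M x l B" "owned M y r C" "B \<inter> C = {}"
    and "{p..<p + 4} \<inter> B = {}" "{p..<p + 4} \<inter> C = {}"
    and "0 \<le> p" "M p = 2" "M (p + 1) = x" "M (p + 2) = y"
  shows "owned M p (Node2 l r) ({p..<p + 4} \<union> B \<union> C)"
proof -
  obtain B' where B': "tree_at M x l B'" "B' \<subseteq> B" using assms(1) by (auto simp: owned_def)
  obtain C' where C': "tree_at M y r C'" "C' \<subseteq> C" using assms(2) by (auto simp: owned_def)
  have sub: "{p..p + 2} \<subseteq> {p..<p + 4}" by auto
  then have "{p..p + 2} \<inter> B' = {}" "{p..p + 2} \<inter> C' = {}" "B' \<inter> C' = {}"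
    using B' C' assms(3-5) by blast+
  then have "tree_at M p (Node2 l r) ({p..p + 2} \<union> B' \<union> C')"
    unfolding tree_at.simps(3) assms(8,9)
    using B'(1) C'(1) assms(6,7) by blast
  moreover have p3: "p + 3 \<in> {p..<p + 4}" by simp
  moreover have "p + 3 \<notin> B'" "p + 3 \<notin> C'" using p3 B'(2) C'(2) assms(4,5) by blast+
  then have "{p..p + 2} \<union> B' \<union> C' \<subseteq> {p..<p + 4} \<union> B \<union> C - {p + 3}"
    using B'(2) C'(2) sub by auto
  ultimately show ?thesis unfolding owned_def by blast
qed

section \<open>Linked lists of roots\<close>

text \<open>A negative head serves as null pointer. With \<open>a \<notin> X\<close>, taking the
  head out of the set leaves exactly the set of the tail, as \<open>bucket_pop\<close>
  needs.\<close>

inductive bucket :: "(int \<Rightarrow> int) \<Rightarrow> int \<Rightarrow> int set \<Rightarrow> bool" for M where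
  empty: "a < 0 \<Longrightarrow> bucket M a {}"
| cons: "0 \<le> a \<Longrightarrow> a \<notin> X \<Longrightarrow> bucket M (M (a + 3)) X \<Longrightarrow> bucket M a (insert a X)"

lemma bucket_emptyD: "bucket M a X \<Longrightarrow> a < 0 \<Longrightarrow> X = {}"
  by (auto elim: bucket.cases)

lemma bucket_pop: "bucket M a X \<Longrightarrow> 0 \<le> a \<Longrightarrow> a \<in> X \<and> bucket M (M (a + 3)) (X - {a})"
  by (erule bucket.cases) auto

lemma bucket_cong:
  "bucket M a X \<Longrightarrow> (\<And>c. c \<in> X \<Longrightarrow> M' (c + 3) = M (c + 3)) \<Longrightarrow> bucket M' a X"
  by (induction rule: bucket.induct) (auto intro: bucket.intros)

section \<open>Forests distributed over buckets\<close>

text \<open>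
  The roots in \<open>S\<close> are distributed over the buckets with heads in the cells \<open>N + v, \<dots>, N + K\<close>.
  The bucket with head \<open>N + u\<close> holds trees of weight at most \<open>b + u\<close>; the blocks lie beyond the
  heads and below \<open>p\<close>.
\<close>

definition forest ::
  "int \<Rightarrow> nat \<Rightarrow> int \<Rightarrow> nat \<Rightarrow> int \<Rightarrow> (int \<Rightarrow> int) \<Rightarrow> int set \<Rightarrow>
   (int \<Rightarrow> nat) \<Rightarrow> (int \<Rightarrow> wtree) \<Rightarrow> (int \<Rightarrow> int set) \<Rightarrow> bool" where
  "forest N K b v p M S lev tr own \<longleftrightarrow>
     0 \<le> N \<and> N + int K < p \<and> finite S \<and> disjoint_family_on own S \<and>
     (\<forall>a\<in>S. v \<le> lev a \<and> lev a \<le> K \<and> weight (tr a) \<le> b + int (lev a) \<and>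
        owned M a (tr a) (own a) \<and> own a \<subseteq> {N + int K<..<p}) \<and>
     (\<forall>u\<in>{v..K}. bucket M (M (N + int u)) {a \<in> S. lev a = u})"

lemma forest_empty:
  assumes "0 \<le> N" "N + int K < p" "\<And>u. u \<le> K \<Longrightarrow> M (N + int u) < 0"
  shows "forest N K b v p M {} lev tr own"
  using assms by (auto simp: forest_def disjoint_family_on_def intro: bucket.empty)

lemma forest_root:
  assumes "forest N K b v p M S lev tr own" "a \<in> S"
  shows "0 \<le> a" "N + int K < a" "a < p" "a + 3 < p"
proof -
  have "owned M a (tr a) (own a)" and sub: "own a \<subseteq> {N + int K<..<p}"
    using assms by (auto simp: forest_def)
  then have "0 \<le> a" "a \<in> own a" "a + 3 \<in> own a" using owned_root by blast+
  then show "0 \<le> a" "N + int K < a" "a < p" "a + 3 < p" using sub by auto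
qed

text \<open>Heads below \<open>N + v\<close> belong to finished levels and cells from
  \<open>p\<close> on are free, so both may be overwritten, and the free region may begin
  later.\<close>

lemma forest_cong:
  assumes F: "forest N K b v p M S lev tr own" and "p \<le> p'"
    and eq: "\<And>c. N + int v \<le> c \<Longrightarrow> c < p \<Longrightarrow> M' c = M c"
  shows "forest N K b v p' M' S lev tr own"
proof -
  have eq': "M' c = M c" if "a \<in> S" "c \<in> own a" for a c
  proof -
    have "v \<le> K" "own a \<subseteq> {N + int K<..<p}" using F that by (force simp: forest_def)+
    then show ?thesis using that by (intro eq) auto
  qed
  have own: "owned M a (tr a) (own a)" if "a \<in> S" for a
    using F that by (simp add: forest_def)
  have "owned M' a (tr a) (own a)" if "a \<in> S" for a
    using own eq' that by (blast intro: owned_cong)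
  moreover have "bucket M' (M' (N + int u)) {a \<in> S. lev a = u}" if "u \<in> {v..K}" for u
  proof -
    have "M' (N + int u) = M (N + int u)" using F that by (intro eq) (auto simp: forest_def)
    moreover have "bucket M (M (N + int u)) {a \<in> S. lev a = u}"
      using F that by (simp add: forest_def)
    moreover have "M' (c + 3) = M (c + 3)" if "c \<in> {a \<in> S. lev a = u}" for c
      using own[of c] owned_root eq' that by blast
    ultimately show ?thesis by (metis (no_types, lifting) bucket_cong)
  qed
  moreover have "own a \<subseteq> {N + int K<..<p'}" if "a \<in> S" for a
    using F \<open>p \<le> p'\<close> that by (force simp: forest_def)
  ultimately show ?thesis using F \<open>p \<le> p'\<close> by (simp add: forest_def)
qed

lemma forest_head_neg:
  assumes "forest N K b v p M S lev tr own" "v \<le> K" "M (N + int v) < 0"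
  shows "\<forall>a\<in>S. v < lev a"
proof -
  have "bucket M (M (N + int v)) {a \<in> S. lev a = v}" using assms by (simp add: forest_def)
  then have "{a \<in> S. lev a = v} = {}" using assms bucket_emptyD by blast
  then show ?thesis using assms(1) by (force simp: forest_def)
qed

lemma forest_Suc:
  assumes "forest N K b v p M S lev tr own" "\<forall>a\<in>S. v < lev a"
  shows "forest N K b (Suc v) p M S lev tr own"
  using assms by (auto simp: forest_def Suc_le_eq)

text \<open>Only a head cell changes, and heads lie outside all owned cells. The last two
  conclusions keep hold of the detached tree until it is pushed again or becomes a subtree.\<close>

lemma forest_pop:
  assumes F: "forest N K b v p M S lev tr own" and "v \<le> K"
    and x: "x = M (N + int v)" "0 \<le> x" and M': "M' = M(N + int v := M (x + 3))"
  shows "x \<in> S" "lev x = v" "forest N K b v p M' (S - {x}) lev tr own"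
    and "owned M' x (tr x) (own x)"
    and "\<And>a. a \<in> S - {x} \<Longrightarrow> own x \<inter> own a = {}"
proof -
  have "bucket M x {a \<in> S. lev a = v}" using F assms by (simp add: forest_def)
  note pop = bucket_pop[OF this x(2)]
  then show x_in: "x \<in> S" and lev: "lev x = v" by auto
  show "own x \<inter> own a = {}" if "a \<in> S - {x}" for a
    using F x_in that by (auto simp: forest_def disjoint_family_on_def)
  have eq: "M' c = M c" if "a \<in> S" "c \<in> own a" for a c
    using F that \<open>v \<le> K\<close> by (fastforce simp: forest_def M')
  have own: "owned M' a (tr a) (own a)" if "a \<in> S" for a
    using F that eq by (auto simp: forest_def intro: owned_cong)
  then show "owned M' x (tr x) (own x)" using x_in by simp
  have eq3: "M' (c + 3) = M (c + 3)" if "c \<in> S" for c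
    using that own owned_root eq by blast
  have "bucket M' (M' (N + int u)) {a \<in> S - {x}. lev a = u}" if u: "u \<in> {v..K}" for u
  proof (cases "u = v")
    case True
    have "{a \<in> S - {x}. lev a = u} = {a \<in> S. lev a = v} - {x}" using True by auto
    moreover have "bucket M' (M (x + 3)) ({a \<in> S. lev a = v} - {x})"
      using pop eq3 by (auto intro: bucket_cong)
    ultimately show ?thesis using True by (simp add: M')
  next
    case False
    have "{a \<in> S - {x}. lev a = u} = {a \<in> S. lev a = u}" using False lev by auto
    moreover have "bucket M (M (N + int u)) {a \<in> S. lev a = u}" using F u by (simp add: forest_def)
    then have "bucket M' (M (N + int u)) {a \<in> S. lev a = u}" using eq3 by (auto intro: bucket_cong)
    moreover have "M' (N + int u) = M (N + int u)" using False by (simp add: M')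
    ultimately show ?thesis by simp
  qed
  then show "forest N K b v p M' (S - {x}) lev tr own"
    using F own by (auto simp: forest_def disjoint_family_on_def)
qed

text \<open>Two cells are written: the link cell of \<open>q\<close>, which lies in \<open>B\<close>
  and hence in no other tree's cells, and a head, which lies below all blocks. Adding a leaf,
  joining and moving up all end with this update.\<close>

lemma forest_push:
  assumes F: "forest N K b v p M S lev tr own" and u: "v \<le> u" "u \<le> K"
    and own: "owned M q t B" "B \<subseteq> {N + int K<..<p}" "\<And>a. a \<in> S \<Longrightarrow> B \<inter> own a = {}"
    and t: "weight t \<le> b + int u"
    and M': "M' = M(q + 3 := M (N + int u), N + int u := q)"
  shows "q \<notin> S"
    and "forest N K b v p M' (insert q S) (lev(q := u)) (tr(q := t)) (own(q := B))"
proof -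
  note q = owned_root[OF own(1)]
  have ownS: "owned M a (tr a) (own a)" "own a \<subseteq> {N + int K<..<p}" if "a \<in> S" for a
    using F that by (auto simp: forest_def)
  show q_nin: "q \<notin> S" using own(3)[of q] q ownS(1) owned_root by blast
  have eqS: "M' c = M c" if "a \<in> S" "c \<in> own a" for a c
  proof -
    have "c \<noteq> q + 3" using q own(3) that by blast
    moreover have "c \<noteq> N + int u" using ownS(2)[OF that(1)] that(2) u by auto
    ultimately show ?thesis by (simp add: M')
  qed
  have eq3: "M' (c + 3) = M (c + 3)" if "c \<in> S" for c
    using that ownS(1) owned_root eqS by blast
  have "owned M' q t B"
  proof (rule owned_cong[OF own(1)])
    fix c assume "c \<in> B" "c \<noteq> q + 3"
    moreover have "c \<noteq> N + int u" using own(2) u \<open>c \<in> B\<close> by auto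
    ultimately show "M' c = M c" by (simp add: M')
  qed
  moreover have "owned M' a (tr a) (own a)" if "a \<in> S" for a
    using ownS(1) eqS that by (blast intro: owned_cong)
  moreover have "bucket M' (M' (N + int i)) {a \<in> insert q S. (lev(q := u)) a = i}"
    if i: "i \<in> {v..K}" for i
  proof -
    have "bucket M (M (N + int i)) {a \<in> S. lev a = i}" using F i by (simp add: forest_def)
    then have b: "bucket M' (M (N + int i)) {a \<in> S. lev a = i}"
      using eq3 by (auto intro: bucket_cong)
    have neq: "q + 3 \<noteq> N + int j" if "j \<le> K" for j
      using q own(2) that by force
    show ?thesis
    proof (cases "i = u")
      case True
      have "{a \<in> insert q S. (lev(q := u)) a = i} = insert q {a \<in> S. lev a = i}"
        using True q_nin by auto
      moreover have "M' (q + 3) = M (N + int i)" using True neq u by (simp add: M')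
      moreover have "M' (N + int i) = q" using True by (simp add: M')
      ultimately show ?thesis using b q q_nin by (simp add: bucket.cons)
    next
      case False
      have "{a \<in> insert q S. (lev(q := u)) a = i} = {a \<in> S. lev a = i}"
        using False q_nin by auto
      moreover have "M' (N + int i) = M (N + int i)"
        using False neq[of i] i by (simp add: M')
      ultimately show ?thesis using b by simp
    qed
  qed
  moreover have "disjoint_family_on (own(q := B)) (insert q S)"
    using F own(3) by (auto simp: forest_def disjoint_family_on_def)
  ultimately show "forest N K b v p M' (insert q S) (lev(q := u)) (tr(q := t)) (own(q := B))"
    using F own u t by (auto simp: forest_def)
qed

section \<open>Merging\<close>

definition kraft :: "int \<Rightarrow> int multiset \<Rightarrow> nat" where
  "kraft b W = (\<Sum>w\<in>#W. 2 ^ nat (w - b))"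

text \<open>
  The term \<open>2 ^ v\<close> bounds the excess caused by moving unpaired trees upwards from levels below \<open>v\<close>.
\<close>

definition merging ::
  "nat \<Rightarrow> int \<Rightarrow> int multiset \<Rightarrow> nat \<Rightarrow> int \<Rightarrow> (int \<Rightarrow> int) \<Rightarrow> int set \<Rightarrow>
   (int \<Rightarrow> nat) \<Rightarrow> (int \<Rightarrow> wtree) \<Rightarrow> (int \<Rightarrow> int set) \<Rightarrow> bool" where
  "merging n b W v p M S lev tr own \<longleftrightarrow>
     forest (int n) (2 * n) b v p M S lev tr own \<and>
     (\<Sum>a\<in>S. leaf_weights (tr a)) = W \<and>
     (\<Sum>a\<in>S. 2 ^ lev a) < kraft b W + 2 ^ v \<and>
     (card S = 1 \<longrightarrow> (\<forall>a\<in>S. v < lev a))"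

text \<open>Two trees of level at least \<open>v\<close> contribute \<open>2 * 2 ^ v\<close>, and
  the excess is below \<open>2 ^ v\<close>, so the Kraft sum is larger than \<open>2 ^ v\<close>.
  Hence merging never runs past the allocated heads: level \<open>Suc v\<close> still has
  one.\<close>

lemma merging_level:
  assumes "merging n b W v p M S lev tr own" "kraft b W \<le> 2 ^ (2 * n)" "1 < card S"
  shows "v < 2 * n"
proof -
  have "2 * 2 ^ v \<le> card S * (2::nat) ^ v" using assms(3) by (intro mult_right_mono) auto
  also have "\<dots> = (\<Sum>a\<in>S. 2 ^ v)" by simp
  also have "\<dots> \<le> (\<Sum>a\<in>S. 2 ^ lev a)"
    using assms(1) by (intro sum_mono power_increasing) (auto simp: merging_def forest_def)
  finally have "2 ^ v < kraft b W" using assms(1) by (simp add: merging_def)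
  then have "(2::nat) ^ v < 2 ^ (2 * n)" using assms(2) by (rule less_le_trans)
  then show ?thesis by simp
qed

lemma merging_skip:
  assumes m: "merging n b W v p M S lev tr own" "kraft b W \<le> 2 ^ (2 * n)" "1 < card S"
    and "M (int n + int v) < 0"
  shows "merging n b W (Suc v) p M S lev tr own"
proof -
  note v = merging_level[OF m]
  have "\<forall>a\<in>S. v < lev a"
    using m(1) v assms(4) forest_head_neg unfolding merging_def by (metis less_imp_le_nat)
  moreover have "(2::nat) ^ v \<le> 2 ^ Suc v" by simp
  ultimately show ?thesis using m forest_Suc by (auto simp: merging_def)
qed

text \<open>Bucket \<open>v\<close> holds only \<open>x\<close>. Raising it adds
  \<open>2 ^ v\<close> to the sum, and \<open>2 ^ v + 2 ^ v = 2 ^ Suc v\<close> is precisely the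
  excess allowed at the next level.\<close>

lemma merging_promote:
  assumes m: "merging n b W v p M S lev tr own" "kraft b W \<le> 2 ^ (2 * n)" "1 < card S"
    and x: "x = M (int n + int v)" "0 \<le> x" and y: "M (x + 3) < 0"
    and M1: "M1 = M(int n + int v := M (x + 3))"
    and M2: "M2 = M1(x + 3 := M1 (int n + int (Suc v)), int n + int (Suc v) := x)"
  shows "merging n b W (Suc v) p M2 S (lev(x := Suc v)) tr own" "x \<in> S"
proof -
  note v = merging_level[OF m]
  have F: "forest (int n) (2 * n) b v p M S lev tr own" using m(1) by (simp add: merging_def)
  note pop = forest_pop[OF F less_imp_le_nat[OF v] x M1]
  show "x \<in> S" by (rule pop(1))
  have "\<forall>a\<in>S - {x}. v < lev a"
    using pop(3) v y by (intro forest_head_neg[OF pop(3)]) (auto simp: M1)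
  then have F1: "forest (int n) (2 * n) b (Suc v) p M1 (S - {x}) lev tr own"
    using pop(3) forest_Suc by blast
  have "own x \<subseteq> {int n + int (2 * n)<..<p}" "weight (tr x) \<le> b + int (Suc v)"
    using F pop(1,2) by (fastforce simp: forest_def)+
  then have "forest (int n) (2 * n) b (Suc v) p M2 (insert x (S - {x})) (lev(x := Suc v))
      (tr(x := tr x)) (own(x := own x))"
    using v by (intro forest_push(2)[OF F1 _ _ pop(4) _ pop(5) _ M2]) auto
  then have F2: "forest (int n) (2 * n) b (Suc v) p M2 S (lev(x := Suc v)) tr own"
    using pop(1) by (simp add: insert_absorb)
  have "finite S" using F by (simp add: forest_def)
  moreover have "(\<Sum>a\<in>S - {x}. 2 ^ (lev(x := Suc v)) a) = (\<Sum>a\<in>S - {x}. (2::nat) ^ lev a)"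
    by (intro sum.cong) auto
  ultimately have
    "(\<Sum>a\<in>S. 2 ^ (lev(x := Suc v)) a) = 2 ^ Suc v + (\<Sum>a\<in>S - {x}. (2::nat) ^ lev a)"
    "(\<Sum>a\<in>S. (2::nat) ^ lev a) = 2 ^ v + (\<Sum>a\<in>S - {x}. 2 ^ lev a)"
    using pop(1,2) by (simp_all add: sum.remove)
  then show "merging n b W (Suc v) p M2 S (lev(x := Suc v)) tr own"
    using m F2 by (simp add: merging_def)
qed

text \<open>Two terms \<open>2 ^ v\<close> are replaced by one term \<open>2 ^ Suc v\<close>, so the
  sum is unchanged and the bound at level \<open>v\<close> persists. The relations between addresses
  serve the symbolic execution in \<open>merge_com_correct\<close>.\<close>

lemma merging_pair:
  assumes m: "merging n b W v p M S lev tr own" "kraft b W \<le> 2 ^ (2 * n)" "1 < card S"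
    and x: "x = M (int n + int v)" "0 \<le> x" and y: "y = M (x + 3)" "0 \<le> y"
    and M1: "M1 = M(int n + int v := y)"
    and M2: "M2 = M1(int n + int v := M1 (y + 3))"
    and M3: "M3 = M2(p := 2, p + 1 := x, p + 2 := y)"
    and M4: "M4 = M3(p + 3 := M3 (int n + int (Suc v)), int n + int (Suc v) := p)"
  obtains lev' tr' own' where
    "merging n b W v (p + 4) M4 (insert p (S - {x} - {y})) lev' tr' own'"
    "card (insert p (S - {x} - {y})) = card S - 1"
    "x + 3 \<noteq> int n + int v" "y + 3 \<noteq> int n + int v" "3 * int n < p"
proof -
  note v = merging_level[OF m]
  have F: "forest (int n) (2 * n) b v p M S lev tr own" using m(1) by (simp add: merging_def)
  have fin: "finite S" and p: "int n + int (2 * n) < p" using F by (simp_all add: forest_def)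
  note pop1 = forest_pop[OF F less_imp_le_nat[OF v] x M1[unfolded y(1)]]
  have "y = M1 (int n + int v)" by (simp add: M1)
  note pop2 = forest_pop[OF pop1(3) less_imp_le_nat[OF v] this y(2) M2]
  have sub: "own x \<subseteq> {int n + int (2 * n)<..<p}" "own y \<subseteq> {int n + int (2 * n)<..<p}"
    and w: "weight (tr x) \<le> b + int v" "weight (tr y) \<le> b + int v"
    using F pop1(1,2) pop2(1,2) by (force simp: forest_def)+
  have eq2: "M2 c = M1 c" if "c \<in> own x" for c
    using that sub(1) v by (auto simp: M2)
  have eq3: "M3 c = M2 c" if "c < p" for c using that by (simp add: M3)
  have F3: "forest (int n) (2 * n) b v (p + 4) M3 (S - {x} - {y}) lev tr own"
    using eq3 by (intro forest_cong[OF pop2(3)]) auto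
  have "owned M3 x (tr x) (own x)"
  proof (rule owned_cong[OF pop1(4)])
    fix c assume "c \<in> own x"
    then show "M3 c = M1 c" using eq2 eq3[of c] sub(1) by auto
  qed
  moreover have "owned M3 y (tr y) (own y)"
    using eq3 sub(2) by (intro owned_cong[OF pop2(4)]) auto
  moreover have "own x \<inter> own y = {}" using pop1(5) pop2(1) by blast
  ultimately have own: "owned M3 p (Node2 (tr x) (tr y)) ({p..<p + 4} \<union> own x \<union> own y)"
    using sub p by (intro owned_Node2) (auto simp: M3)
  let ?S = "S - {x} - {y}"
  have disj: "({p..<p + 4} \<union> own x \<union> own y) \<inter> own a = {}" if a: "a \<in> ?S" for a
  proof -
    have "own a \<subseteq> {int n + int (2 * n)<..<p}" using F a by (simp add: forest_def)
    then have "{p..<p + 4} \<inter> own a = {}" by auto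
    then show ?thesis using pop1(5)[of a] pop2(5)[of a] a by blast
  qed
  have "{p..<p + 4} \<union> own x \<union> own y \<subseteq> {int n + int (2 * n)<..<p + 4}"
    using sub p by auto
  then have push: "p \<notin> ?S"
    "forest (int n) (2 * n) b v (p + 4) M4 (insert p ?S) (lev(p := Suc v))
      (tr(p := Node2 (tr x) (tr y))) (own(p := {p..<p + 4} \<union> own x \<union> own y))"
    using v w by (intro forest_push[OF F3 _ _ own _ disj _ M4]; simp)+
  have y_in: "y \<in> S - {x}" by (rule pop2(1))
  have card: "card (insert p ?S) = card S - 1"
    using push(1) fin pop1(1) pop2(1) m(3) by (simp add: card_Diff_singleton)
  \<comment> \<open>This rule and the next are polymorphic because they are applied to sums of
    multisets and to sums of powers of two.\<close>
  have remove: "sum f S = f x + (f y + sum f ?S)" for f :: "int \<Rightarrow> 'a::comm_monoid_add"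
    using fin pop1(1) pop2(1) by (simp add: sum.remove)
  have upd: "(\<Sum>a\<in>insert p ?S. g ((h(p := c)) a)) = g c + (\<Sum>a\<in>?S. g (h a))"
    for g :: "'b \<Rightarrow> 'a::comm_monoid_add" and h c
  proof -
    have "(\<Sum>a\<in>?S. g ((h(p := c)) a)) = (\<Sum>a\<in>?S. g (h a))"
      using push(1) by (intro sum.cong) auto
    then show ?thesis using push(1) fin by (subst sum.insert) auto
  qed
  let ?lev = "lev(p := Suc v)" and ?tr = "tr(p := Node2 (tr x) (tr y))"
  have "(\<Sum>a\<in>insert p ?S. leaf_weights (?tr a)) = (\<Sum>a\<in>S. leaf_weights (tr a))"
    unfolding upd[of leaf_weights] remove[of "\<lambda>a. leaf_weights (tr a)"] by (simp add: ac_simps)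
  moreover have "(\<Sum>a\<in>insert p ?S. (2::nat) ^ ?lev a) = (\<Sum>a\<in>S. 2 ^ lev a)"
    unfolding upd[of "\<lambda>i. (2::nat) ^ i"] remove[of "\<lambda>a. (2::nat) ^ lev a"]
    using pop1(2) pop2(2) by simp
  \<comment> \<open>If a single tree remains, it is the new one, which has level
    \<open>Suc v\<close>; this gives the last conjunct of \<open>merging\<close>.\<close>
  moreover have "?S = {}" if "card (insert p ?S) = 1" using that push(1) fin by simp
  then have "card (insert p ?S) = 1 \<longrightarrow> (\<forall>a\<in>insert p ?S. v < ?lev a)" by force
  ultimately have "merging n b W v (p + 4) M4 (insert p ?S) ?lev ?tr
      (own(p := {p..<p + 4} \<union> own x \<union> own y))"
    using m(1) push(2) by (simp only: merging_def)
  then show ?thesis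
  proof (rule that)
    show "card (insert p ?S) = card S - 1" by (rule card)
    show "x + 3 \<noteq> int n + int v" "y + 3 \<noteq> int n + int v"
      using forest_root(2)[OF F, of x] forest_root(2)[OF F, of y] pop1(1) y_in v by auto
    show "3 * int n < p" using p by simp
  qed
qed

lemma merging_minimax:
  assumes m: "merging n b W v p M S lev tr own" and S: "card S = 1" "a \<in> S"
    and n: "size W = n" and max: "b + int n \<in># W"
  shows "\<exists>A. tree_at M a (tr a) A" "minimax_tree W (tr a)"
proof -
  have Sa: "S = {a}" using S by (auto simp: card_1_singleton_iff)
  have F: "forest (int n) (2 * n) b v p M S lev tr own" using m by (simp add: merging_def)
  then show "\<exists>A. tree_at M a (tr a) A" using S by (force simp: forest_def owned_def)
  have W: "leaf_weights (tr a) = W" and lev: "v < lev a" "2 ^ lev a < kraft b W + 2 ^ v"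
    using m S(1) by (auto simp: merging_def Sa)
  have "weight (tr a) \<le> weight t" if t: "leaf_weights t = W" for t
  proof -
    \<comment> \<open>\<open>b + n\<close> is one of the weights, so every competitor meets the size
      hypothesis of \<open>kraft_clamped\<close>.\<close>
    have "b + int n \<le> weight t" using max weight_ge_leaf t by blast
    then have "kraft b W \<le> 2 ^ nat (weight t - b)"
      using kraft_clamped[of t "weight t" b] t n by (simp add: kraft_def)
    \<comment> \<open>The last conjunct of \<open>merging\<close> gives \<open>v < lev a\<close>, so
      the excess \<open>2 ^ v\<close> is at most half of \<open>2 ^ lev a\<close>, and the Kraft sum
      must exceed the other half.\<close>
    moreover have "(2::nat) ^ lev a = 2 * 2 ^ (lev a - 1)" "(2::nat) ^ v \<le> 2 ^ (lev a - 1)"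
      using lev(1) by (auto simp flip: power_Suc)
    ultimately have "(2::nat) ^ (lev a - 1) < 2 ^ nat (weight t - b)" using lev(2) by linarith
    then have "lev a - 1 < nat (weight t - b)" by simp
    then have "b + int (lev a) \<le> weight t" by linarith
    moreover have "weight (tr a) \<le> b + int (lev a)" using F S by (simp add: forest_def)
    ultimately show ?thesis by simp
  qed
  then show "minimax_tree W (tr a)"
    using W by (auto simp: minimax_tree_def is_arg_min_linorder)
qed

section \<open>The program\<close>

text \<open>Memory layout: the weights in cells \<open>0\<close> to \<open>n - 1\<close>, the bucket
  heads of levels \<open>0\<close> to \<open>2 * n\<close> in cells \<open>n\<close> to
  \<open>3 * n\<close>, tree blocks of four cells from \<open>3 * n + 1\<close> on.\<close>

abbreviation (input) "n_reg \<equiv> 0 :: reg"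
abbreviation (input) "p_reg \<equiv> 2 :: reg"
abbreviation (input) "head_reg \<equiv> 3 :: reg"
abbreviation (input) "count_reg \<equiv> 4 :: reg"
abbreviation (input) "x_reg \<equiv> 5 :: reg"
abbreviation (input) "y_reg \<equiv> 6 :: reg"
abbreviation (input) "t_reg \<equiv> 7 :: reg"
abbreviation (input) "z_reg \<equiv> 8 :: reg"
abbreviation (input) "q_reg \<equiv> 9 :: reg"
abbreviation (input) "next_reg \<equiv> 10 :: reg"
abbreviation (input) "i_reg \<equiv> 11 :: reg"
abbreviation (input) "w_reg \<equiv> 12 :: reg"
abbreviation (input) "b_reg \<equiv> 13 :: reg"
abbreviation (input) "d_reg \<equiv> 14 :: reg"
abbreviation (input) "limit_reg \<equiv> 15 :: reg"
abbreviation (input) "zero_reg \<equiv> 16 :: reg"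
abbreviation (input) "one_reg \<equiv> 17 :: reg"
abbreviation (input) "two_reg \<equiv> 18 :: reg"
abbreviation (input) "three_reg \<equiv> 19 :: reg"
abbreviation (input) "four_reg \<equiv> 20 :: reg"
abbreviation (input) "neg_reg \<equiv> 21 :: reg"

definition constants :: "(reg \<Rightarrow> int) \<Rightarrow> bool" where
  "constants R \<longleftrightarrow> R zero_reg = 0 \<and> R one_reg = 1 \<and> R two_reg = 2 \<and> R three_reg = 3 \<and>
     R four_reg = 4 \<and> R neg_reg = -1"

definition push_com :: com where
  "push_com = block [Add t_reg q_reg three_reg, Load z_reg next_reg, Store t_reg z_reg,
     Store next_reg q_reg]"

text \<open>The branches realise \<open>merging_skip\<close>, \<open>merging_promote\<close> and
  \<open>merging_pair\<close>. After a join the same bucket is inspected again; without an inner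
  loop, one measure bounds the whole phase.\<close>

definition merge_com :: com where
  "merge_com = block [Add next_reg head_reg one_reg, Load x_reg head_reg,
     IfLess x_reg zero_reg (Add head_reg next_reg zero_reg)
       (block [Add t_reg x_reg three_reg, Load y_reg t_reg, Store head_reg y_reg,
          IfLess y_reg zero_reg
            (block [Add q_reg x_reg zero_reg, Add head_reg next_reg zero_reg])
            (block [Add t_reg y_reg three_reg, Load z_reg t_reg, Store head_reg z_reg,
               Store p_reg two_reg, Add t_reg p_reg one_reg, Store t_reg x_reg,
               Add t_reg t_reg one_reg, Store t_reg y_reg,
               Add q_reg p_reg zero_reg, Add p_reg p_reg four_reg,
               Sub count_reg count_reg one_reg]),
          push_com])]"

text \<open>\<open>q_reg\<close> always holds some root of the forest, hence the only one when the
  loop ends.\<close>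

definition merge_inv :: "nat \<Rightarrow> int \<Rightarrow> int multiset \<Rightarrow> state \<Rightarrow> bool" where
  "merge_inv n b W s \<longleftrightarrow> constants (fst s) \<and>
     (\<exists>v S lev tr own. merging n b W v (fst s p_reg) (snd s) S lev tr own \<and>
        fst s head_reg = int n + int v \<and> fst s count_reg = int (card S) \<and> fst s q_reg \<in> S)"

text \<open>Joining removes a tree, the other two steps advance the head. The phase starts with
  \<open>n\<close> trees and \<open>2 * n\<close> levels to go, hence with
  \<open>3 * n\<close>.\<close>

definition merge_measure :: "nat \<Rightarrow> state \<Rightarrow> nat" where
  "merge_measure n s = nat (fst s count_reg) + nat (3 * int n - fst s head_reg)"

lemma merge_com_correct:
  assumes I: "merge_inv n b W s" and less: "fst s one_reg < fst s count_reg"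
    and kraft: "kraft b W \<le> 2 ^ (2 * n)"
  shows "runs merge_com s (cost merge_com)
    (\<lambda>s'. merge_inv n b W s' \<and> merge_measure n s' < merge_measure n s)"
proof (rule runs_wp)
  obtain R M where s: "s = (R, M)" by force
  obtain v S lev tr own where m: "merging n b W v (R p_reg) M S lev tr own"
    and head: "R head_reg = int n + int v" and count: "R count_reg = int (card S)"
    and q: "R q_reg \<in> S" and const: "constants R"
    using I by (auto simp: merge_inv_def s)
  have S: "1 < card S" using less const count by (simp add: s constants_def)
  \<comment> \<open>The bound \<open>v < 2 * n\<close> keeps the second summand of the measure
    positive, so that advancing the head lowers it despite \<open>nat\<close>.\<close>
  note v = merging_level[OF m kraft S]
  have hd: "int n + int v = R head_reg" "int n + int (Suc v) = R head_reg + 1"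
    using head by simp_all
  define x where "x = M (R head_reg)"
  define y where "y = M (x + 3)"
  define Q where "Q = (\<lambda>s'. merge_inv n b W s' \<and> merge_measure n s' < merge_measure n s)"
  have QI: "Q (R', M')"
    if "merging n b W v' p' M' S' lev' tr' own'" "R' q_reg \<in> S'" "R' p_reg = p'"
      "R' head_reg = int n + int v'" "R' count_reg = int (card S')" "constants R'"
      "card S' < card S \<and> v' = v \<or> card S' = card S \<and> v' = Suc v"
    for R' M' v' p' S' lev' tr' own'
    unfolding Q_def merge_inv_def merge_measure_def
    using that count head v by (auto simp: s)
  consider "x < 0" | "0 \<le> x" "y < 0" | "0 \<le> x" "0 \<le> y" by linarith
  then have "wp merge_com Q s"
  proof cases
    case 1
    then have "merging n b W (Suc v) (R p_reg) M S lev tr own"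
      using merging_skip[OF m kraft S, unfolded hd] by (simp add: x_def)
    moreover have "0 \<le> R head_reg" using head by simp
    ultimately show ?thesis
      using 1 const count q hd(2)
      by (simp add: s merge_com_def constants_def x_def[symmetric] QI)
  next
    case 2
    define M1 where "M1 = M(R head_reg := y)"
    define M2 where "M2 = M1(x + 3 := M1 (R head_reg + 1), R head_reg + 1 := x)"
    have "merging n b W (Suc v) (R p_reg) M2 S (lev(x := Suc v)) tr own" and "x \<in> S"
      by (rule merging_promote[OF m kraft S, unfolded hd,
          OF x_def 2(1) 2(2)[unfolded y_def] M1_def[unfolded y_def] M2_def])+
    moreover have "0 \<le> R head_reg" using head by simp
    ultimately show ?thesis
      using 2 const count hd(2)
      by (simp add: s merge_com_def push_com_def constants_def x_def[symmetric] y_def[symmetric]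
          QI M1_def M2_def)
  next
    case 3
    define z where "z = M (y + 3)"
    define p where "p = R p_reg"
    define M1 where "M1 = M(R head_reg := y)"
    define M2 where "M2 = M1(R head_reg := M1 (y + 3))"
    define M3 where "M3 = M2(p := 2, p + 1 := x, p + 2 := y)"
    define M4 where "M4 = M3(p + 3 := M3 (R head_reg + 1), R head_reg + 1 := p)"
    obtain lev' tr' own' where
      "merging n b W v (p + 4) M4 (insert p (S - {x} - {y})) lev' tr' own'"
      and card: "card (insert p (S - {x} - {y})) = card S - 1"
      and neq: "x + 3 \<noteq> R head_reg" "y + 3 \<noteq> R head_reg" "3 * int n < p"
      by (rule merging_pair[OF m kraft S, unfolded hd,
          OF x_def 3(1) y_def 3(2) M1_def M2_def M3_def[unfolded p_def] M4_def[unfolded p_def]])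
        (simp add: p_def)
    moreover have "0 \<le> R head_reg" "R head_reg + 1 < p" using head v neq(3) by simp_all
    ultimately show ?thesis
      using 3 const count S hd(1)
      by (simp add: s merge_com_def push_com_def constants_def x_def[symmetric] y_def[symmetric]
          z_def[symmetric] p_def[symmetric] add.commute[of 2 p] QI M1_def M2_def M3_def M4_def)
  qed
  then show "wp merge_com (\<lambda>s'. merge_inv n b W s' \<and> merge_measure n s' < merge_measure n s) s"
    by (simp add: Q_def)
qed

section \<open>Preparatory phases: maximum, empty buckets, leaves\<close>

definition setup_com :: com where
  "setup_com = block [SetConst zero_reg 0, SetConst one_reg 1, SetConst two_reg 2,
     SetConst three_reg 3, SetConst four_reg 4, SetConst neg_reg (-1),
     Load b_reg zero_reg, SetConst i_reg 0]"

definition max_com :: com where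
  "max_com = block [Load w_reg i_reg, IfLess b_reg w_reg (Add b_reg w_reg zero_reg) Skip,
     Add i_reg i_reg one_reg]"

definition base_com :: com where
  "base_com = block [Sub b_reg b_reg n_reg, Add p_reg n_reg zero_reg, Add limit_reg n_reg n_reg,
     Add limit_reg limit_reg n_reg, Add limit_reg limit_reg one_reg]"

text \<open>The sweep over the heads moves \<open>p_reg\<close> itself, so it ends with
  \<open>p_reg\<close> at \<open>3 * n + 1\<close>, where the allocation of blocks begins.\<close>

definition clear_com :: com where
  "clear_com = block [Store p_reg neg_reg, Add p_reg p_reg one_reg]"

text \<open>Only the choice of the bucket uses the truncated level; the label stored is the original
  weight.\<close>

definition leaf_com :: com where
  "leaf_com = block [Load w_reg i_reg, Sub d_reg w_reg b_reg,
     IfLess d_reg zero_reg (SetConst d_reg 0) Skip,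
     Store p_reg zero_reg, Add t_reg p_reg one_reg, Store t_reg w_reg,
     Add q_reg p_reg zero_reg, Add p_reg p_reg four_reg, Add next_reg n_reg d_reg,
     push_com, Add i_reg i_reg one_reg]"

definition minimax_com :: com where
  "minimax_com = block [setup_com, WhileLess i_reg n_reg max_com, base_com,
     WhileLess p_reg limit_reg clear_com, SetConst i_reg 0, WhileLess i_reg n_reg leaf_com,
     block [Add head_reg n_reg zero_reg, Add count_reg n_reg zero_reg],
     WhileLess one_reg count_reg merge_com, Add 0 q_reg zero_reg]"

definition input_inv :: "int list \<Rightarrow> state \<Rightarrow> bool" where
  "input_inv ws s \<longleftrightarrow> constants (fst s) \<and> fst s n_reg = int (length ws) \<and>
     (\<forall>j<length ws. snd s (int j) = ws ! j)"

definition max_inv :: "int list \<Rightarrow> state \<Rightarrow> bool" where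
  "max_inv ws s \<longleftrightarrow> input_inv ws s \<and> fst s b_reg \<in> set ws \<and>
     (\<exists>i\<le>length ws. fst s i_reg = int i \<and> (\<forall>w\<in>set (take i ws). w \<le> fst s b_reg))"

lemma max_com_correct:
  assumes "max_inv ws s" "fst s i_reg < fst s n_reg"
  shows "runs max_com s (cost max_com) (\<lambda>s'. max_inv ws s' \<and>
    nat (fst s' n_reg - fst s' i_reg) < nat (fst s n_reg - fst s i_reg))"
proof (rule runs_wp)
  obtain R M where s: "s = (R, M)" by force
  obtain i where i: "R i_reg = int i" "\<forall>w\<in>set (take i ws). w \<le> R b_reg"
    and I: "input_inv ws s" "R b_reg \<in> set ws"
    using assms(1) by (auto simp: max_inv_def s)
  have "i < length ws" using assms(2) i I by (simp add: s input_inv_def)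
  moreover from this have "M (int i) = ws ! i" using I by (simp add: s input_inv_def)
  moreover have "\<forall>w\<in>set (take i ws). w \<le> ws ! i" if "R b_reg < ws ! i" using i(2) that by fastforce
  ultimately show "wp max_com (\<lambda>s'. max_inv ws s' \<and>
    nat (fst s' n_reg - fst s' i_reg) < nat (fst s n_reg - fst s i_reg)) s"
    using i I
    by (auto simp: s max_com_def max_inv_def input_inv_def constants_def take_Suc_conv_app_nth
        intro!: exI[of _ "Suc i"])
qed

definition clear_inv :: "int list \<Rightarrow> int \<Rightarrow> state \<Rightarrow> bool" where
  "clear_inv ws b s \<longleftrightarrow> input_inv ws s \<and> fst s b_reg = b \<and>
     fst s limit_reg = 3 * int (length ws) + 1 \<and>
     int (length ws) \<le> fst s p_reg \<and> fst s p_reg \<le> fst s limit_reg \<and>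
     (\<forall>c\<in>{int (length ws)..<fst s p_reg}. snd s c < 0)"

lemma clear_com_correct:
  assumes "clear_inv ws b s" "fst s p_reg < fst s limit_reg"
  shows "runs clear_com s (cost clear_com) (\<lambda>s'. clear_inv ws b s' \<and>
    nat (fst s' limit_reg - fst s' p_reg) < nat (fst s limit_reg - fst s p_reg))"
proof (rule runs_wp)
  obtain R M where s: "s = (R, M)" by force
  show "wp clear_com (\<lambda>s'. clear_inv ws b s' \<and>
    nat (fst s' limit_reg - fst s' p_reg) < nat (fst s limit_reg - fst s p_reg)) s"
    using assms by (auto simp: s clear_com_def clear_inv_def input_inv_def constants_def)
qed

text \<open>No tree has been moved yet, so the sum of powers equals the Kraft sum without excess.
  The clause on \<open>q_reg\<close> supplies the root that \<open>merge_inv\<close> asks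
  for.\<close>

definition leaf_inv :: "int list \<Rightarrow> int \<Rightarrow> state \<Rightarrow> bool" where
  "leaf_inv ws b s \<longleftrightarrow> input_inv ws s \<and> fst s b_reg = b \<and>
     (\<exists>i S lev tr own. i \<le> length ws \<and> fst s i_reg = int i \<and> card S = i \<and>
        (0 < i \<longrightarrow> fst s q_reg \<in> S) \<and>
        (\<Sum>a\<in>S. leaf_weights (tr a)) = mset (take i ws) \<and>
        (\<Sum>a\<in>S. 2 ^ lev a) = kraft b (mset (take i ws)) \<and>
        forest (int (length ws)) (2 * length ws) b 0 (fst s p_reg) (snd s) S lev tr own)"

lemma forest_add_leaf:
  assumes F: "forest N K b v p M S lev tr own" and u: "v \<le> u" "u \<le> K" "w \<le> b + int u"
    and M1: "M1 = M(p := 0, p + 1 := w)"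
    and M2: "M2 = M1(p + 3 := M1 (N + int u), N + int u := p)"
  shows "p \<notin> S"
    and "forest N K b v (p + 4) M2 (insert p S) (lev(p := u)) (tr(p := Leaf w))
      (own(p := {p..<p + 4}))"
proof -
  have p: "0 \<le> N" "N + int K < p" using F by (simp_all add: forest_def)
  have F1: "forest N K b v (p + 4) M1 S lev tr own"
    by (rule forest_cong[OF F]) (auto simp: M1)
  have own: "owned M1 p (Leaf w) {p..<p + 4}"
    using p by (intro owned_Leaf) (auto simp: M1)
  have disj: "{p..<p + 4} \<inter> own a = {}" if "a \<in> S" for a
  proof -
    have "own a \<subseteq> {N + int K<..<p}" using F that by (simp add: forest_def)
    then show ?thesis by auto
  qed
  have sub: "{p..<p + 4} \<subseteq> {N + int K<..<p + 4}" using p by auto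
  show "p \<notin> S"
    by (rule forest_push(1)[OF F1 u(1,2) own sub disj _ M2]) (use u in auto)
  show "forest N K b v (p + 4) M2 (insert p S) (lev(p := u)) (tr(p := Leaf w))
      (own(p := {p..<p + 4}))"
    by (rule forest_push(2)[OF F1 u(1,2) own sub disj _ M2]) (use u in auto)
qed

lemma leaf_com_correct:
  assumes I: "leaf_inv ws b s" and less: "fst s i_reg < fst s n_reg"
    and b: "\<forall>w\<in>set ws. w \<le> b + int (length ws)"
  shows "runs leaf_com s (cost leaf_com) (\<lambda>s'. leaf_inv ws b s' \<and>
    nat (fst s' n_reg - fst s' i_reg) < nat (fst s n_reg - fst s i_reg))"
proof (rule runs_wp)
  obtain R M where s: "s = (R, M)" by force
  let ?n = "int (length ws)"
  obtain i S lev tr own where i: "R i_reg = int i" and S: "card S = i"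
    and sums: "(\<Sum>a\<in>S. leaf_weights (tr a)) = mset (take i ws)"
      "(\<Sum>a\<in>S. 2 ^ lev a) = kraft b (mset (take i ws))"
    and F: "forest ?n (2 * length ws) b 0 (R p_reg) M S lev tr own"
    and inp: "input_inv ws s" "R b_reg = b"
    using I by (auto simp: leaf_inv_def s)
  have i_less: "i < length ws" using less i inp by (simp add: s input_inv_def)
  define w where "w = M (int i)"
  have w: "w = ws ! i" using inp i_less by (simp add: s input_inv_def w_def)
  define u where "u = nat (w - b)"
  define h where "h = ?n + int u"
  define p where "p = R p_reg"
  have "w \<le> b + ?n" using b i_less by (simp add: w)
  then have u: "u \<le> length ws" by (simp add: u_def)
  define M1 where "M1 = M(p := 0, p + 1 := w)"
  define M2 where "M2 = M1(p + 3 := M1 h, h := p)"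
  have push: "p \<notin> S"
    "forest ?n (2 * length ws) b 0 (p + 4) M2 (insert p S) (lev(p := u)) (tr(p := Leaf w))
      (own(p := {p..<p + 4}))"
    using forest_add_leaf[OF F _ _ _ M1_def[unfolded p_def] M2_def[unfolded p_def h_def]] u
    by (simp_all add: u_def p_def)
  have p: "2 * ?n < p" "?n + ?n + ?n < p" and fin: "finite S" using F by (simp_all add: p_def forest_def)
  have take: "mset (take (Suc i) ws) = add_mset w (mset (take i ws))"
    using i_less by (simp add: take_Suc_conv_app_nth w)
  have "(\<Sum>a\<in>S. leaf_weights ((tr(p := Leaf w)) a)) = (\<Sum>a\<in>S. leaf_weights (tr a))"
    "(\<Sum>a\<in>S. (2::nat) ^ (lev(p := u)) a) = (\<Sum>a\<in>S. 2 ^ lev a)"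
    using push(1) by (auto intro!: sum.cong)
  then have sums': "(\<Sum>a\<in>insert p S. leaf_weights ((tr(p := Leaf w)) a)) = mset (take (Suc i) ws)"
    "(\<Sum>a\<in>insert p S. 2 ^ (lev(p := u)) a) = kraft b (mset (take (Suc i) ws))"
    unfolding take using push(1) fin sums by (simp_all add: kraft_def u_def)
  have h: "?n \<le> h" "h < p" using u p by (simp_all add: h_def)
  \<comment> \<open>Heads and blocks lie beyond the input cells, so the weights not yet read
    survive.\<close>
  have M2: "M2 (int j) = M (int j)" if "j < length ws" for j
    using that h p by (simp add: M2_def M1_def)
  define Q where "Q = (\<lambda>s'. leaf_inv ws b s' \<and>
    nat (fst s' n_reg - fst s' i_reg) < nat (fst s n_reg - fst s i_reg))"
  have QI: "Q (R', M2)"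
    if "R' n_reg = ?n" "R' b_reg = b" "R' i_reg = int i + 1" "R' q_reg = p" "R' p_reg = p + 4"
      "constants R'" for R'
  proof -
    have "input_inv ws (R', M2)" using that inp M2 by (simp add: s input_inv_def)
    moreover have "card (insert p S) = Suc i" using push(1) fin S by simp
    moreover have "forest ?n (2 * length ws) b 0 (R' p_reg) M2 (insert p S) (lev(p := u))
      (tr(p := Leaf w)) (own(p := {p..<p + 4}))"
      using push(2) that by (simp del: fun_upd_apply)
    moreover have "int i + 1 = int (Suc i)" "R' q_reg \<in> insert p S" using that by simp_all
    ultimately have "leaf_inv ws b (R', M2)"
      unfolding leaf_inv_def fst_conv snd_conv using that(2,3) i_less sums' Suc_leI by metis
    then show ?thesis
      unfolding Q_def using that inp(1) i i_less by (simp add: s input_inv_def)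
  qed
  have "wp leaf_com Q s"
  \<comment> \<open>The two branches of the program's test yield the two cases of
    \<open>nat (w - b)\<close>.\<close>
  proof (cases "w < b")
    case True
    then have "h = ?n" by (simp add: h_def u_def)
    then show ?thesis using True inp i h p QI
      by (simp add: s leaf_com_def push_com_def input_inv_def constants_def w_def[symmetric]
          p_def[symmetric] M2_def M1_def)
  next
    case False
    then have "h = ?n + (w - b)" by (simp add: h_def u_def)
    then show ?thesis using False inp i h p QI
      by (simp add: s leaf_com_def push_com_def input_inv_def constants_def w_def[symmetric]
          p_def[symmetric] M2_def M1_def)
  qed
  then show "wp leaf_com (\<lambda>s'. leaf_inv ws b s' \<and>
    nat (fst s' n_reg - fst s' i_reg) < nat (fst s n_reg - fst s i_reg)) s"
    by (simp add: Q_def)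
qed

section \<open>Assembling the phases\<close>

text \<open>Each of the \<open>n\<close> leaves contributes at most \<open>2 ^ n\<close>, and
  \<open>n <= 2 ^ n\<close>. This is why heads up to level \<open>2 * n\<close> suffice.\<close>

lemma kraft_le:
  assumes "\<forall>w\<in>#W. w \<le> b + int (size W)"
  shows "kraft b W \<le> 2 ^ (2 * size W)"
proof -
  have "kraft b W \<le> (\<Sum>w\<in>#W. 2 ^ size W)"
    unfolding kraft_def using assms by (intro sum_mset_mono power_increasing) auto
  also have "\<dots> = size W * 2 ^ size W" by simp
  also have "\<dots> \<le> 2 ^ size W * 2 ^ size W" by (intro mult_right_mono) (simp_all add: less_imp_le)
  also have "\<dots> = 2 ^ (2 * size W)" by (simp add: mult_2 power_add)
  finally show ?thesis .
qed

lemma minimax_com_correct: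
  assumes "W \<noteq> {#}" "input_state W s"
  shows "runs minimax_com s (1000 * size W) (\<lambda>s'. \<exists>t. output_tree s' t \<and> minimax_tree W t)"
proof -
  obtain ws where ws: "mset ws = W" "fst s n_reg = int (length ws)"
    "\<forall>i<length ws. snd s (int i) = ws ! i"
    using assms(2) by (auto simp: input_state_def)
  define n where "n = length ws"
  have n: "0 < n" "size W = n" using assms(1) ws(1) by (auto simp: n_def)
  define b where "b = Max (set ws) - int n"
  have Max: "b + int n \<in># W" and le: "\<forall>w\<in>set ws. w \<le> b + int n"
    using n ws(1) by (auto simp: b_def n_def)
  have kraft: "kraft b W \<le> 2 ^ (2 * n)" using kraft_le[of W b] le ws(1) n(2) by auto
  \<comment> \<open>Assertions between the phases: the odd ones hold before a loop and fix the
    initial value of its measure, the even ones hold after it, when its test fails.\<close>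
  define P1 where "P1 = (\<lambda>s'. max_inv ws s' \<and> nat (fst s' n_reg - fst s' i_reg) = n)"
  define P2 where "P2 = (\<lambda>s'. max_inv ws s' \<and> \<not> fst s' i_reg < fst s' n_reg)"
  define P3 where
    "P3 = (\<lambda>s'. clear_inv ws b s' \<and> nat (fst s' limit_reg - fst s' p_reg) = 2 * n + 1)"
  define P4 where "P4 = (\<lambda>s'. clear_inv ws b s' \<and> \<not> fst s' p_reg < fst s' limit_reg)"
  define P5 where "P5 = (\<lambda>s'. leaf_inv ws b s' \<and> nat (fst s' n_reg - fst s' i_reg) = n)"
  define P6 where "P6 = (\<lambda>s'. leaf_inv ws b s' \<and> \<not> fst s' i_reg < fst s' n_reg)"
  define P7 where "P7 = (\<lambda>s'. merge_inv n b W s' \<and> merge_measure n s' = 3 * n)"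
  define P8 where "P8 = (\<lambda>s'. merge_inv n b W s' \<and> \<not> fst s' one_reg < fst s' count_reg)"
  have 1: "runs setup_com s (cost setup_com) P1"
  proof (rule runs_wp)
    obtain R M where s: "s = (R, M)" by force
    \<comment> \<open>As \<open>n > 0\<close>, cell \<open>0\<close> holds a weight, which serves as
      the initial maximum.\<close>
    have "M 0 \<in> set ws" using ws(3) n(1) by (fastforce simp: s n_def)
    then show "wp setup_com P1 s"
      using ws n by (auto simp: s setup_com_def P1_def max_inv_def input_inv_def constants_def n_def)
  qed
  have 2: "runs (WhileLess i_reg n_reg max_com) s' (1 + (1 + cost max_com) * n) P2" if "P1 s'" for s'
  proof -
    have "runs (WhileLess i_reg n_reg max_com) s' (1 + (1 + cost max_com) * nat (fst s' n_reg - fst s' i_reg))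
      (\<lambda>s. max_inv ws s \<and> \<not> fst s i_reg < fst s n_reg)"
      by (rule runs_While[where \<mu> = "\<lambda>s. nat (fst s n_reg - fst s i_reg)"], erule max_com_correct, assumption)
        (use that in \<open>simp_all add: P1_def\<close>)
    then show ?thesis using that by (simp add: P1_def P2_def)
  qed
  have 3: "runs base_com s' (cost base_com) P3" if "P2 s'" for s'
  proof (rule runs_wp)
    obtain R M where s: "s' = (R, M)" by force
    have R: "R b_reg \<in> set ws" "\<forall>w\<in>set ws. w \<le> R b_reg" and inp: "input_inv ws s'"
      using that by (auto simp: P2_def max_inv_def input_inv_def s)
    then have "R b_reg = Max (set ws)" by (metis Max_eqI List.finite_set)
    then show "wp base_com P3 s'"
      using inp by (auto simp: s base_com_def P3_def clear_inv_def input_inv_def constants_def n_def b_def)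
  qed
  have 4: "runs (WhileLess p_reg limit_reg clear_com) s' (1 + (1 + cost clear_com) * (2 * n + 1)) P4"
    if "P3 s'" for s'
  proof -
    have "runs (WhileLess p_reg limit_reg clear_com) s' (1 + (1 + cost clear_com) * nat (fst s' limit_reg - fst s' p_reg))
      (\<lambda>s. clear_inv ws b s \<and> \<not> fst s p_reg < fst s limit_reg)"
      by (rule runs_While[where \<mu> = "\<lambda>s. nat (fst s limit_reg - fst s p_reg)"], erule clear_com_correct, assumption)
        (use that in \<open>simp_all add: P3_def\<close>)
    then show ?thesis using that by (simp only: P3_def P4_def)
  qed
  have 5: "runs (SetConst i_reg 0) s' (cost (SetConst i_reg 0)) P5" if "P4 s'" for s'
  proof (rule runs_wp)
    obtain R M where s: "s' = (R, M)" by force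
    have "\<exists>lev tr own. forest (int n) (2 * n) b 0 (R p_reg) M {} lev tr own"
      using that by (intro exI forest_empty) (auto simp: P4_def clear_inv_def s n_def)
    then show "wp (SetConst i_reg 0) P5 s'"
      using that unfolding P5_def P4_def leaf_inv_def clear_inv_def
      by (force simp: s input_inv_def constants_def n_def kraft_def intro!: exI[of _ "{}"])
  qed
  have 6: "runs (WhileLess i_reg n_reg leaf_com) s' (1 + (1 + cost leaf_com) * n) P6" if "P5 s'" for s'
  proof -
    have "runs (WhileLess i_reg n_reg leaf_com) s' (1 + (1 + cost leaf_com) * nat (fst s' n_reg - fst s' i_reg))
      (\<lambda>s. leaf_inv ws b s \<and> \<not> fst s i_reg < fst s n_reg)"
      by (rule runs_While[where \<mu> = "\<lambda>s. nat (fst s n_reg - fst s i_reg)"], erule leaf_com_correct, assumption)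
        (use that le n_def in \<open>simp_all add: P5_def\<close>)
    then show ?thesis using that by (simp add: P5_def P6_def)
  qed
  have 7: "runs (block [Add head_reg n_reg zero_reg, Add count_reg n_reg zero_reg]) s'
    (cost (block [Add head_reg n_reg zero_reg, Add count_reg n_reg zero_reg])) P7" if P6: "P6 s'" for s'
  proof (rule runs_wp)
    obtain R M where s: "s' = (R, M)" by force
    obtain i S lev tr own where i: "i \<le> n" "R i_reg = int i" and S: "card S = i"
      "0 < i \<longrightarrow> R q_reg \<in> S"
      and sums: "(\<Sum>a\<in>S. leaf_weights (tr a)) = mset (take i ws)"
        "(\<Sum>a\<in>S. 2 ^ lev a) = kraft b (mset (take i ws))"
      and F: "forest (int n) (2 * n) b 0 (R p_reg) M S lev tr own"
      and inp: "input_inv ws s'"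
      using P6 unfolding P6_def leaf_inv_def s fst_conv snd_conv
      by (elim conjE exE) (rule that[unfolded n_def s])
    have "i = n" using P6 i inp by (auto simp: P6_def input_inv_def s n_def)
    \<comment> \<open>If \<open>n = 1\<close>, the sole weight is \<open>b + 1\<close> and its level
      is \<open>1\<close>: taking \<open>b\<close> as the maximum minus \<open>n\<close> makes the
      last conjunct of \<open>merging\<close> true from the outset.\<close>
    moreover have "0 < lev a" if a: "a \<in> S" "card S = 1" for a
    proof -
      obtain w where "W = {#w#}" using n(2) a(2) \<open>i = n\<close> S(1) size_1_singleton_mset by metis
      then have "W = {#b + int n#}" using Max by simp
      moreover have "S = {a}" using that by (auto simp: card_1_singleton_iff)
      ultimately show ?thesis using sums ws(1) \<open>i = n\<close> n S that by (simp add: kraft_def n_def)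
    qed
    \<comment> \<open>The strict bound holds at level \<open>0\<close> because the sums agree and
      \<open>2 ^ 0\<close> is positive.\<close>
    ultimately have "merging n b W 0 (R p_reg) M S lev tr own"
      using F sums ws(1) by (auto simp: merging_def n_def)
    then show "wp (block [Add head_reg n_reg zero_reg, Add count_reg n_reg zero_reg]) P7 s'"
      using inp S n \<open>i = n\<close>
      by (force simp: s P7_def merge_inv_def merge_measure_def input_inv_def constants_def n_def
          intro!: exI[of _ 0] exI[of _ S])
  qed
  have 8: "runs (WhileLess one_reg count_reg merge_com) s' (1 + (1 + cost merge_com) * (3 * n)) P8"
    if "P7 s'" for s'
  proof -
    have "runs (WhileLess one_reg count_reg merge_com) s' (1 + (1 + cost merge_com) * merge_measure n s')
      (\<lambda>s. merge_inv n b W s \<and> \<not> fst s one_reg < fst s count_reg)"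
      by (rule runs_While[where \<mu> = "merge_measure n"], erule merge_com_correct, assumption)
        (use that kraft in \<open>simp_all add: P7_def\<close>)
    then show ?thesis using that by (simp add: P7_def P8_def)
  qed
  have 9: "runs (block [Add 0 q_reg zero_reg]) s' (cost (block [Add 0 q_reg zero_reg]))
    (\<lambda>s'. \<exists>t. output_tree s' t \<and> minimax_tree W t)" if P8: "P8 s'" for s'
  proof (rule runs_wp)
    obtain R M where s: "s' = (R, M)" by force
    obtain v S lev tr own where m: "merging n b W v (R p_reg) M S lev tr own"
      and S: "R count_reg = int (card S)" "R q_reg \<in> S" and const: "constants R"
      using P8 by (auto simp: P8_def merge_inv_def s)
    have "finite S" using m by (simp add: merging_def forest_def)
    then have "0 < card S" using S(2) by (auto simp: card_gt_0_iff)
    moreover have "card S \<le> 1" using P8 S(1) const by (simp add: P8_def s constants_def)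
    ultimately have "card S = 1" by simp
    note merging_minimax[OF m this S(2) n(2) Max]
    then show "wp (block [Add 0 q_reg zero_reg]) (\<lambda>s'. \<exists>t. output_tree s' t \<and> minimax_tree W t) s'"
      using const by (auto simp: s output_tree_def constants_def)
  qed
  have "runs minimax_com s
    (cost setup_com + ((1 + (1 + cost max_com) * n) + (cost base_com +
      ((1 + (1 + cost clear_com) * (2 * n + 1)) + (cost (SetConst i_reg 0) +
        ((1 + (1 + cost leaf_com) * n) +
          (cost (block [Add head_reg n_reg zero_reg, Add count_reg n_reg zero_reg]) +
            ((1 + (1 + cost merge_com) * (3 * n)) + cost (block [Add 0 q_reg zero_reg])))))))))
    (\<lambda>s'. \<exists>t. output_tree s' t \<and> minimax_tree W t)"
    \<comment> \<open>Fixing the head of the list unfolds only the outer sequence of phases; the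
      inner blocks and the final one stay folded, as in the facts \<open>1\<close> to
      \<open>9\<close>.\<close>
    unfolding minimax_com_def block.simps(2)[of setup_com] block.simps(2)[of "WhileLess _ _ _"]
      block.simps(2)[of base_com] block.simps(2)[of "SetConst _ _"] block.simps(2)[of "block _"]
    by (rule runs_Seq, rule 1, rule runs_Seq, erule 2, rule runs_Seq, erule 3, rule runs_Seq,
        erule 4, rule runs_Seq, erule 5, rule runs_Seq, erule 6, rule runs_Seq, erule 7,
        rule runs_Seq, erule 8, erule 9)
  \<comment> \<open>The total is linear in \<open>n\<close> plus a constant, which
    \<open>n > 0\<close> absorbs; the factor \<open>1000\<close> is generous.\<close>
  then show ?thesis
  proof (rule runs_mono)
  qed (use n in \<open>simp add: setup_com_def max_com_def base_com_def clear_com_def leaf_com_def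
      merge_com_def push_com_def\<close>)
qed

theorem theorem1:
  "\<exists>(prog :: com) (T :: nat \<Rightarrow> nat).
     (\<lambda>n. real (T n)) \<in> O(\<lambda>n. real n) \<and>
     (\<forall>(W :: int multiset) (s :: state). W \<noteq> {#} \<longrightarrow> input_state W s \<longrightarrow>
        (\<exists>k s' t. exec prog s k s' \<and> k \<le> T (size W) \<and> output_tree s' t \<and> minimax_tree W t))"
proof (rule exI[of _ minimax_com], rule exI[of _ "\<lambda>n. 1000 * n"], intro conjI allI impI)
  show "(\<lambda>n. real (1000 * n)) \<in> O(\<lambda>n. real n)" by simp
  show "\<exists>k s' t. exec minimax_com s k s' \<and> k \<le> 1000 * size W \<and> output_tree s' t \<and>
    minimax_tree W t" if "W \<noteq> {#}" "input_state W s" for W s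
    using minimax_com_correct[OF that] unfolding runs_def by blast
qed

end
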